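(* For every positive integer $n$ and every permutation $\pi\in S_3$, we have $L_n(\pi)=n$.
   Context: An $n$-th order Latin Square is an $n\times n$ grid filled with the symbols $1,2,\dots,n$ such that each symbol appears exactly once in each row and exactly once in each column. Reading each row from left to right gives a permutation of $\{1,\dots,n\}$ (a row permutation), and reading each column from top to bottom gives a permutation (a column permutation). A permutation $\sigma$ of length $n$ contains a pattern $\pi\in S_k$ ($k\le n$) if some subsequence of $\sigma$ of length $k$ is order isomorphic to $\pi$ (its entries appear in the same relative order as the entries of $\pi$); otherwise $\sigma$ avoids $\pi$. A Latin Square avoids $\pi$ if all of its row permutations and all of its column permutations avoid $\pi$. $L_n(\pi)$ denotes the number of $n$-th order Latin Squares avoiding $\pi$. *)

theory Defs
  imports "HOL-Library.FuncSet" "HOL-Combinatorics.Permutations"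
begin

text \<open>
  Permutations of length \<open>n\<close> are functions considered on \<open>{1..n}\<close> only, written in one-line
  notation as \<open>\<sigma> 1, \<dots>, \<sigma> n\<close>. The function \<open>f\<close> below lists, in increasing order, the positions
  of a subsequence of length \<open>k\<close>; such an \<open>f\<close> can only exist if \<open>k \<le> n\<close>.
\<close>

definition contains_pattern :: "nat \<Rightarrow> (nat \<Rightarrow> nat) \<Rightarrow> nat \<Rightarrow> (nat \<Rightarrow> nat) \<Rightarrow> bool" where
  "contains_pattern n \<sigma> k \<pi> \<longleftrightarrow>
     (\<exists>f \<in> {1..k} \<rightarrow> {1..n}. strict_mono_on {1..k} f \<and>
        (\<forall>a\<in>{1..k}. \<forall>b\<in>{1..k}. \<sigma> (f a) < \<sigma> (f b) \<longleftrightarrow> \<pi> a < \<pi> b))"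

abbreviation avoids_pattern :: "nat \<Rightarrow> (nat \<Rightarrow> nat) \<Rightarrow> nat \<Rightarrow> (nat \<Rightarrow> nat) \<Rightarrow> bool" where
  "avoids_pattern n \<sigma> k \<pi> \<equiv> \<not> contains_pattern n \<sigma> k \<pi>"

text \<open>
  \<open>L i j\<close> is the entry in row \<open>i\<close> and column \<open>j\<close>. The extensional function space fixes the
  values outside the grid, so that distinct functions are distinct grids and counting is meaningful.
\<close>

definition latin_squares :: "nat \<Rightarrow> (nat \<Rightarrow> nat \<Rightarrow> nat) set" where
  "latin_squares n = {L \<in> {1..n} \<rightarrow>\<^sub>E ({1..n} \<rightarrow>\<^sub>E {1..n}).
     (\<forall>i\<in>{1..n}. \<forall>s\<in>{1..n}. \<exists>!j. j \<in> {1..n} \<and> L i j = s) \<and>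
     (\<forall>j\<in>{1..n}. \<forall>s\<in>{1..n}. \<exists>!i. i \<in> {1..n} \<and> L i j = s)}"

definition latin_square_avoids :: "nat \<Rightarrow> (nat \<Rightarrow> nat \<Rightarrow> nat) \<Rightarrow> nat \<Rightarrow> (nat \<Rightarrow> nat) \<Rightarrow> bool" where
  "latin_square_avoids n L k \<pi> \<longleftrightarrow>
     (\<forall>i\<in>{1..n}. avoids_pattern n (\<lambda>j. L i j) k \<pi>) \<and>
     (\<forall>j\<in>{1..n}. avoids_pattern n (\<lambda>i. L i j) k \<pi>)"

definition num_avoiding_latin_squares :: "nat \<Rightarrow> nat \<Rightarrow> (nat \<Rightarrow> nat) \<Rightarrow> nat" where
  "num_avoiding_latin_squares n k \<pi> =
     card {L \<in> latin_squares n. latin_square_avoids n L k \<pi>}"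

end

theory Submission
  imports Defs
begin

text \<open>
  Call a row a decreasing cycle if it reads \<open>k, k - 1, \<dots>, 1, n, n - 1, \<dots>, k + 1\<close>. If all rows
  avoid \<open>123\<close>, then the rows starting with \<open>k = 1, 2, \<dots>\<close> are forced, one after the other, to be
  decreasing cycles; if all rows avoid \<open>312\<close>, the same happens for \<open>k = n, n - 1, \<dots>\<close>.
  As the columns satisfy the same hypothesis, the first column is a decreasing cycle as well, and
  so the square is determined by its top left entry. Reversal and complementation reduce the other
  four patterns to these two.
\<close>

section \<open>Patterns\<close>

text \<open>Each pair is compared in both directions because neither \<open>\<sigma>\<close> nor
  \<open>\<pi>\<close> is assumed injective; comparing an index with itself is false on both
  sides.\<close>

lemma contains_pattern_3_iff:
  "contains_pattern n \<sigma> 3 \<pi> \<longleftrightarrow>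
     (\<exists>a b c. 1 \<le> a \<and> a < b \<and> b < c \<and> c \<le> n \<and>
        (\<sigma> a < \<sigma> b \<longleftrightarrow> \<pi> 1 < \<pi> 2) \<and> (\<sigma> b < \<sigma> a \<longleftrightarrow> \<pi> 2 < \<pi> 1) \<and>
        (\<sigma> a < \<sigma> c \<longleftrightarrow> \<pi> 1 < \<pi> 3) \<and> (\<sigma> c < \<sigma> a \<longleftrightarrow> \<pi> 3 < \<pi> 1) \<and>
        (\<sigma> b < \<sigma> c \<longleftrightarrow> \<pi> 2 < \<pi> 3) \<and> (\<sigma> c < \<sigma> b \<longleftrightarrow> \<pi> 3 < \<pi> 2))"
  (is "?C \<longleftrightarrow> ?R")
proof -
  have three: "{1..3} = {1, 2, 3::nat}" by auto
  show ?thesis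
  proof
    assume ?C
    then obtain f where f: "f \<in> {1..3} \<rightarrow> {1..n}" "strict_mono_on {1..3} f"
      "\<forall>a\<in>{1..3}. \<forall>b\<in>{1..3}. \<sigma> (f a) < \<sigma> (f b) \<longleftrightarrow> \<pi> a < \<pi> b"
      unfolding contains_pattern_def by blast
    have "1 \<le> f 1" "f 3 \<le> n" using f(1) unfolding three by auto
    moreover have "f 1 < f 2" "f 2 < f 3"
      using f(2) by (auto simp: strict_mono_on_def)
    ultimately show ?R
      using f(3) unfolding three by (intro exI[of _ "f 1"] exI[of _ "f 2"] exI[of _ "f 3"]) simp
  next
    assume ?R
    then obtain a b c where abc: "1 \<le> a" "a < b" "b < c" "c \<le> n"
      and ord: "\<sigma> a < \<sigma> b \<longleftrightarrow> \<pi> 1 < \<pi> 2" "\<sigma> b < \<sigma> a \<longleftrightarrow> \<pi> 2 < \<pi> 1"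
        "\<sigma> a < \<sigma> c \<longleftrightarrow> \<pi> 1 < \<pi> 3" "\<sigma> c < \<sigma> a \<longleftrightarrow> \<pi> 3 < \<pi> 1"
        "\<sigma> b < \<sigma> c \<longleftrightarrow> \<pi> 2 < \<pi> 3" "\<sigma> c < \<sigma> b \<longleftrightarrow> \<pi> 3 < \<pi> 2"
      by blast
    define f where "f x = (if x = 1 then a else if x = 2 then b else c)" for x :: nat
    have "f \<in> {1..3} \<rightarrow> {1..n}" "strict_mono_on {1..3} f"
      using abc unfolding three by (auto simp: f_def strict_mono_on_def)
    moreover have "\<forall>a\<in>{1..3}. \<forall>b\<in>{1..3}. \<sigma> (f a) < \<sigma> (f b) \<longleftrightarrow> \<pi> a < \<pi> b"
      using ord unfolding three by (auto simp: f_def)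
    ultimately show ?C unfolding contains_pattern_def by blast
  qed
qed

lemma contains_pattern_cong:
  assumes "\<And>i. i \<in> {1..n} \<Longrightarrow> \<sigma> i = \<tau> i" "\<And>a. a \<in> {1..k} \<Longrightarrow> \<pi> a = \<rho> a"
  shows "contains_pattern n \<sigma> k \<pi> \<longleftrightarrow> contains_pattern n \<tau> k \<rho>"
  unfolding contains_pattern_def using assms
  by (intro bex_cong refl conj_cong ball_cong) (auto simp: Pi_iff)

section \<open>Reversal and complementation of an occurrence\<close>

text \<open>Positions are reflected through \<open>n + 1\<close> and indices through
  \<open>k + 1\<close>; the two order reversals cancel, so \<open>g\<close> is increasing. One
  implication suffices, since applying it to the reversed data gives the converse.\<close>

lemma contains_pattern_rev:
  assumes "contains_pattern n \<sigma> k \<pi>"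
  shows "contains_pattern n (\<lambda>i. \<sigma> (n + 1 - i)) k (\<lambda>a. \<pi> (k + 1 - a))"
proof -
  obtain f where f: "f \<in> {1..k} \<rightarrow> {1..n}" "strict_mono_on {1..k} f"
    "\<And>a b. a \<in> {1..k} \<Longrightarrow> b \<in> {1..k} \<Longrightarrow> \<sigma> (f a) < \<sigma> (f b) \<longleftrightarrow> \<pi> a < \<pi> b"
    using assms unfolding contains_pattern_def by blast
  define g where "g a = n + 1 - f (k + 1 - a)" for a
  have r: "k + 1 - a \<in> {1..k}" if "a \<in> {1..k}" for a using that by auto
  have fr: "1 \<le> f a" "f a \<le> n" if "a \<in> {1..k}" for a using f(1) that by auto
  have g: "n + 1 - g a = f (k + 1 - a)" if "a \<in> {1..k}" for a
    using fr[OF r[OF that]] by (simp add: g_def)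
  have "g \<in> {1..k} \<rightarrow> {1..n}"
    using fr[OF r] by (fastforce simp: g_def Pi_iff)
  moreover have "strict_mono_on {1..k} g"
  proof (rule strict_mono_onI)
    fix a b assume ab: "a \<in> {1..k}" "b \<in> {1..k}" "a < b"
    then have "f (k + 1 - b) < f (k + 1 - a)"
      using f(2) r by (intro strict_mono_onD[of "{1..k}" f]) auto
    then show "g a < g b" using fr[OF r[OF ab(1)]] by (simp add: g_def)
  qed
  moreover have "\<forall>a\<in>{1..k}. \<forall>b\<in>{1..k}.
      \<sigma> (n + 1 - g a) < \<sigma> (n + 1 - g b) \<longleftrightarrow> \<pi> (k + 1 - a) < \<pi> (k + 1 - b)"
    using f(3)[OF r r] g by simp
  ultimately show ?thesis unfolding contains_pattern_def by blast
qed

text \<open>The same positions work, as every comparison is reversed on both sides. The range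
  hypotheses keep the truncated subtractions strictly decreasing.\<close>

lemma contains_pattern_compl:
  assumes "\<sigma> ` {1..n} \<subseteq> {1..n}" "\<pi> ` {1..k} \<subseteq> {1..k}" "contains_pattern n \<sigma> k \<pi>"
  shows "contains_pattern n (\<lambda>i. n + 1 - \<sigma> i) k (\<lambda>a. k + 1 - \<pi> a)"
proof -
  obtain f where f: "f \<in> {1..k} \<rightarrow> {1..n}" "strict_mono_on {1..k} f"
    "\<And>a b. a \<in> {1..k} \<Longrightarrow> b \<in> {1..k} \<Longrightarrow> \<sigma> (f a) < \<sigma> (f b) \<longleftrightarrow> \<pi> a < \<pi> b"
    using assms(3) unfolding contains_pattern_def by blast
  have flip: "m + 1 - x < m + 1 - y \<longleftrightarrow> y < x" if "x \<le> m" "y \<le> m" for x y m :: nat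
    using that by auto
  have "\<sigma> (f a) \<le> n" "\<pi> a \<le> k" if "a \<in> {1..k}" for a
    using assms(1,2) f(1) that by (auto simp: image_subset_iff Pi_iff)
  then have "\<forall>a\<in>{1..k}. \<forall>b\<in>{1..k}.
      n + 1 - \<sigma> (f a) < n + 1 - \<sigma> (f b) \<longleftrightarrow> k + 1 - \<pi> a < k + 1 - \<pi> b"
    using f(3) flip by simp
  then show ?thesis using f(1,2) unfolding contains_pattern_def by blast
qed

section \<open>Latin squares\<close>

text \<open>Only values on the grid are constrained, so transposing, rotating and complementing stay
  inside this notion whether or not extensionality survives.\<close>

definition latin_grid :: "nat \<Rightarrow> (nat \<Rightarrow> nat \<Rightarrow> nat) \<Rightarrow> bool" where
  "latin_grid n L \<longleftrightarrow>
     (\<forall>i\<in>{1..n}. bij_betw (L i) {1..n} {1..n}) \<and>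
     (\<forall>j\<in>{1..n}. bij_betw (\<lambda>i. L i j) {1..n} {1..n})"

lemma bij_betw_iff_ex1:
  assumes "f ` A \<subseteq> B"
  shows "bij_betw f A B \<longleftrightarrow> (\<forall>s\<in>B. \<exists>!x. x \<in> A \<and> f x = s)"
  using assms unfolding bij_betw_def inj_on_def by (auto simp: image_subset_iff)

lemma latin_squares_iff:
  "L \<in> latin_squares n \<longleftrightarrow> L \<in> {1..n} \<rightarrow>\<^sub>E ({1..n} \<rightarrow>\<^sub>E {1..n}) \<and> latin_grid n L"
proof (cases "L \<in> {1..n} \<rightarrow>\<^sub>E ({1..n} \<rightarrow>\<^sub>E {1..n})")
  case True
  then have m: "L i j \<in> {1..n}" if "i \<in> {1..n}" "j \<in> {1..n}" for i j using that by blast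
  have "bij_betw (L i) {1..n} {1..n} \<longleftrightarrow> (\<forall>s\<in>{1..n}. \<exists>!j. j \<in> {1..n} \<and> L i j = s)"
    if "i \<in> {1..n}" for i
    using m that by (intro bij_betw_iff_ex1) blast
  moreover have "bij_betw (\<lambda>i. L i j) {1..n} {1..n} \<longleftrightarrow> (\<forall>s\<in>{1..n}. \<exists>!i. i \<in> {1..n} \<and> L i j = s)"
    if "j \<in> {1..n}" for j
    using m that by (intro bij_betw_iff_ex1) blast
  ultimately show ?thesis using True unfolding latin_squares_def latin_grid_def by simp
next
  case False
  then show ?thesis unfolding latin_squares_def by blast
qed

lemma latin_grid_transpose: "latin_grid n L \<Longrightarrow> latin_grid n (\<lambda>i j. L j i)"
  unfolding latin_grid_def by blast

lemma latin_gridD: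
  assumes "latin_grid n L" "i \<in> {1..n}"
  shows "j \<in> {1..n} \<Longrightarrow> L i j \<in> {1..n}"
    and "j \<in> {1..n} \<Longrightarrow> j' \<in> {1..n} \<Longrightarrow> L i j = L i j' \<Longrightarrow> j = j'"
    and "s \<in> {1..n} \<Longrightarrow> \<exists>j\<in>{1..n}. L i j = s"
proof -
  have *: "bij_betw (L i) {1..n} {1..n}" using assms unfolding latin_grid_def by blast
  show "j \<in> {1..n} \<Longrightarrow> L i j \<in> {1..n}" using * bij_betwE by blast
  show "j \<in> {1..n} \<Longrightarrow> j' \<in> {1..n} \<Longrightarrow> L i j = L i j' \<Longrightarrow> j = j'"
    using bij_betw_imp_inj_on[OF *] by (meson inj_onD)
  show "s \<in> {1..n} \<Longrightarrow> \<exists>j\<in>{1..n}. L i j = s"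
    using bij_betw_imp_surj_on[OF *] by (metis imageE)
qed

lemma latin_grid_cong:
  assumes "\<And>i j. i \<in> {1..n} \<Longrightarrow> j \<in> {1..n} \<Longrightarrow> L i j = M i j"
  shows "latin_grid n L \<longleftrightarrow> latin_grid n M"
  unfolding latin_grid_def using assms
  by (intro arg_cong2[where f = "(\<and>)"] ball_cong refl bij_betw_cong) auto

lemma latin_square_avoids_cong:
  assumes "\<And>i j. i \<in> {1..n} \<Longrightarrow> j \<in> {1..n} \<Longrightarrow> L i j = M i j"
  shows "latin_square_avoids n L k \<pi> \<longleftrightarrow> latin_square_avoids n M k \<pi>"
  unfolding latin_square_avoids_def using assms
  by (intro arg_cong2[where f = "(\<and>)"] ball_cong refl arg_cong[where f = Not]
      contains_pattern_cong) auto

section \<open>Canonical representatives and symmetries of the count\<close>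

text \<open>Among all functions that agree on the grid, this picks the one that
  \<open>latin_squares\<close> counts.\<close>

definition restrict_grid :: "nat \<Rightarrow> (nat \<Rightarrow> nat \<Rightarrow> nat) \<Rightarrow> nat \<Rightarrow> nat \<Rightarrow> nat" where
  "restrict_grid n L = (\<lambda>i\<in>{1..n}. \<lambda>j\<in>{1..n}. L i j)"

lemma restrict_grid_apply [simp]:
  "i \<in> {1..n} \<Longrightarrow> j \<in> {1..n} \<Longrightarrow> restrict_grid n L i j = L i j"
  by (simp add: restrict_grid_def)

lemma restrict_grid_latin_square:
  assumes "latin_grid n L"
  shows "restrict_grid n L \<in> latin_squares n"
proof -
  have "restrict_grid n L \<in> {1..n} \<rightarrow>\<^sub>E ({1..n} \<rightarrow>\<^sub>E {1..n})"
    using latin_gridD(1)[OF assms] by (auto simp: restrict_grid_def)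
  moreover have "latin_grid n (restrict_grid n L)"
    using assms latin_grid_cong[of n "restrict_grid n L" L] by simp
  ultimately show ?thesis by (simp add: latin_squares_iff)
qed

lemma restrict_grid_eqI:
  assumes "M \<in> latin_squares n" "\<And>i j. i \<in> {1..n} \<Longrightarrow> j \<in> {1..n} \<Longrightarrow> L i j = M i j"
  shows "restrict_grid n L = M"
proof -
  have M: "M \<in> {1..n} \<rightarrow>\<^sub>E ({1..n} \<rightarrow>\<^sub>E {1..n})" using assms(1) by (simp add: latin_squares_iff)
  have "restrict_grid n L \<in> {1..n} \<rightarrow>\<^sub>E ({1..n} \<rightarrow>\<^sub>E {1..n})"
    using assms(2) PiE_mem[OF PiE_mem[OF M]]
    unfolding restrict_grid_def restrict_PiE_iff by simp
  moreover have "restrict_grid n L i = M i" if i: "i \<in> {1..n}" for i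
  proof (rule PiE_ext[OF _ PiE_mem[OF M i]])
    show "restrict_grid n L i \<in> {1..n} \<rightarrow>\<^sub>E {1..n}" using calculation i by (rule PiE_mem)
  qed (use assms(2) i in simp)
  ultimately show ?thesis by (rule PiE_ext[OF _ M])
qed

text \<open>\<open>F\<close> followed by restriction is its own inverse, hence a bijection between
  the two sets of avoiding squares. Restriction may alter \<open>F L\<close> off the grid before
  \<open>F\<close> is applied again, so \<open>invol\<close> allows any \<open>M\<close> that agrees
  with \<open>F L\<close> on the grid.\<close>

lemma num_avoiding_latin_squares_involution:
  assumes latin: "\<And>L. latin_grid n L \<Longrightarrow> latin_grid n (F L)"
    and avoids: "\<And>L. latin_grid n L \<Longrightarrow>
      latin_square_avoids n (F L) k \<rho> \<longleftrightarrow> latin_square_avoids n L k \<pi>"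
    and invol: "\<And>L M i j. latin_grid n L \<Longrightarrow> i \<in> {1..n} \<Longrightarrow> j \<in> {1..n} \<Longrightarrow>
      (\<And>i j. i \<in> {1..n} \<Longrightarrow> j \<in> {1..n} \<Longrightarrow> M i j = F L i j) \<Longrightarrow> F M i j = L i j"
  shows "num_avoiding_latin_squares n k \<rho> = num_avoiding_latin_squares n k \<pi>"
proof -
  let ?A = "\<lambda>\<pi>. {L \<in> latin_squares n. latin_square_avoids n L k \<pi>}"
  let ?F = "\<lambda>L. restrict_grid n (F L)"
  have FF: "?F (?F L) = L" if "L \<in> latin_squares n" for L
  proof (rule restrict_grid_eqI[OF that])
    fix i j assume "i \<in> {1..n}" "j \<in> {1..n}"
    then show "F (?F L) i j = L i j"
      using that by (intro invol) (simp_all add: latin_squares_iff)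
  qed
  have avoids': "latin_square_avoids n (?F L) k \<rho> \<longleftrightarrow> latin_square_avoids n L k \<pi>"
    if "latin_grid n L" for L
    using avoids[OF that] latin_square_avoids_cong[of n "?F L" "F L"] by simp
  have FL: "?F L \<in> latin_squares n" if "L \<in> latin_squares n" for L
    using that by (intro restrict_grid_latin_square latin) (simp add: latin_squares_iff)
  have "bij_betw ?F (?A \<pi>) (?A \<rho>)"
  proof (rule bij_betw_byWitness[where f' = ?F])
    show "?F ` ?A \<pi> \<subseteq> ?A \<rho>" using FL avoids' by (auto simp: latin_squares_iff)
    show "?F ` ?A \<rho> \<subseteq> ?A \<pi>"
    \<comment> \<open>The equivalence \<open>avoids'\<close> is applied to \<open>?F L\<close>,
      whose image is \<open>L\<close> again by \<open>FF\<close>.\<close>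
    proof clarify
      fix L assume L: "L \<in> latin_squares n" "latin_square_avoids n L k \<rho>"
      then have "latin_square_avoids n (?F (?F L)) k \<rho>" by (simp add: FF)
      then have "latin_square_avoids n (?F L) k \<pi>"
        using avoids' FL[OF L(1)] by (simp add: latin_squares_iff)
      then show "?F L \<in> latin_squares n \<and> latin_square_avoids n (?F L) k \<pi>"
        using FL L(1) by blast
    qed
  qed (auto simp: FF)
  then show ?thesis
    unfolding num_avoiding_latin_squares_def by (simp add: bij_betw_same_card)
qed

lemma bij_betw_reflect: "bij_betw (\<lambda>i. n + 1 - i) {1..n} {1..n::nat}"
  by (rule bij_betw_byWitness[where f' = "\<lambda>i. n + 1 - i"]) auto

text \<open>A half-turn of the grid reverses all rows and all columns at once. Reflecting one
  coordinate alone would reverse the words in one direction but only permute those in the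
  other.\<close>

lemma num_avoiding_latin_squares_rev:
  "num_avoiding_latin_squares n k (\<lambda>a. \<pi> (k + 1 - a)) = num_avoiding_latin_squares n k \<pi>"
proof (rule num_avoiding_latin_squares_involution[where F = "\<lambda>L i j. L (n + 1 - i) (n + 1 - j)"])
  fix L assume L: "latin_grid n L"
  have r: "n + 1 - i \<in> {1..n}" if "i \<in> {1..n}" for i using that by auto
  have comp: "bij_betw (\<lambda>i. \<sigma> (n + 1 - i)) {1..n} {1..n}"
    if "bij_betw \<sigma> {1..n} {1..n}" for \<sigma> :: "nat \<Rightarrow> nat"
    using bij_betw_trans[OF bij_betw_reflect that] by (simp add: o_def)
  show "latin_grid n (\<lambda>i j. L (n + 1 - i) (n + 1 - j))"
    unfolding latin_grid_def
  proof (intro conjI ballI)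
    fix i assume "i \<in> {1..n}"
    with r have i: "n + 1 - i \<in> {1..n}" .
    show "bij_betw (\<lambda>j. L (n + 1 - i) (n + 1 - j)) {1..n} {1..n}"
      using L i unfolding latin_grid_def by (intro comp) blast
    show "bij_betw (\<lambda>j. L (n + 1 - j) (n + 1 - i)) {1..n} {1..n}"
      using L i unfolding latin_grid_def by (intro comp[of "\<lambda>j. L j (n + 1 - i)"]) blast
  qed
  have rev: "contains_pattern n (\<lambda>i. \<sigma> (n + 1 - i)) k (\<lambda>a. \<pi> (k + 1 - a)) \<longleftrightarrow>
      contains_pattern n \<sigma> k \<pi>" for \<sigma>
  proof
    assume "contains_pattern n (\<lambda>i. \<sigma> (n + 1 - i)) k (\<lambda>a. \<pi> (k + 1 - a))"
    from contains_pattern_rev[OF this] show "contains_pattern n \<sigma> k \<pi>"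
      by (subst (asm) contains_pattern_cong[where \<tau> = \<sigma> and \<rho> = \<pi>]) auto
  qed (rule contains_pattern_rev)
  \<comment> \<open>The half-turn also reverses the order in which rows and columns are listed; a
    condition on all of them is unaffected.\<close>
  have refl_ball: "(\<forall>i\<in>{1..n}. P (n + 1 - i)) \<longleftrightarrow> (\<forall>i\<in>{1..n}. P i)" for P
    using bij_betw_imp_surj_on[OF bij_betw_reflect, of n] by (metis imageE image_eqI)
  show "latin_square_avoids n (\<lambda>i j. L (n + 1 - i) (n + 1 - j)) k (\<lambda>a. \<pi> (k + 1 - a)) \<longleftrightarrow>
      latin_square_avoids n L k \<pi>"
    using refl_ball[of "\<lambda>i. avoids_pattern n (L i) k \<pi>"]
      refl_ball[of "\<lambda>j. avoids_pattern n (\<lambda>i. L i j) k \<pi>"]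
    unfolding latin_square_avoids_def rev[of "L (n + 1 - i)" for i]
      rev[of "\<lambda>i. L i (n + 1 - j)" for j] by blast
next
  fix L M :: "nat \<Rightarrow> nat \<Rightarrow> nat" and i j
  assume ij: "i \<in> {1..n}" "j \<in> {1..n}"
    and M: "\<And>i j. i \<in> {1..n} \<Longrightarrow> j \<in> {1..n} \<Longrightarrow> M i j = L (n + 1 - i) (n + 1 - j)"
  have "n + 1 - i \<in> {1..n}" "n + 1 - j \<in> {1..n}" using ij by auto
  from M[OF this] show "M (n + 1 - i) (n + 1 - j) = L i j" using ij by simp
qed

lemma num_avoiding_latin_squares_compl:
  assumes \<pi>: "\<pi> ` {1..k} \<subseteq> {1..k}"
  shows "num_avoiding_latin_squares n k (\<lambda>a. k + 1 - \<pi> a) = num_avoiding_latin_squares n k \<pi>"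
proof (rule num_avoiding_latin_squares_involution[where F = "\<lambda>L i j. n + 1 - L i j"])
  fix L assume L: "latin_grid n L"
  have "bij_betw (\<lambda>i. n + 1 - \<sigma> i) {1..n} {1..n}"
    if "bij_betw \<sigma> {1..n} {1..n}" for \<sigma> :: "nat \<Rightarrow> nat"
    using bij_betw_trans[OF that bij_betw_reflect] by (simp add: o_def)
  with L show "latin_grid n (\<lambda>i j. n + 1 - L i j)"
    unfolding latin_grid_def by simp
  have compl: "contains_pattern n (\<lambda>i. n + 1 - \<sigma> i) k (\<lambda>a. k + 1 - \<pi> a) \<longleftrightarrow>
      contains_pattern n \<sigma> k \<pi>" if \<sigma>: "\<sigma> ` {1..n} \<subseteq> {1..n}" for \<sigma>
  proof
    assume *: "contains_pattern n (\<lambda>i. n + 1 - \<sigma> i) k (\<lambda>a. k + 1 - \<pi> a)"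
    have "(\<lambda>i. n + 1 - \<sigma> i) ` {1..n} \<subseteq> {1..n}" "(\<lambda>a. k + 1 - \<pi> a) ` {1..k} \<subseteq> {1..k}"
      using \<sigma> \<pi> by fastforce+
    from contains_pattern_compl[OF this *]
    have "contains_pattern n (\<lambda>i. n + 1 - (n + 1 - \<sigma> i)) k (\<lambda>a. k + 1 - (k + 1 - \<pi> a))" .
    \<comment> \<open>Undoing a complement needs the range hypotheses, since subtraction
      truncates.\<close>
    moreover have "n + 1 - (n + 1 - \<sigma> i) = \<sigma> i" if "i \<in> {1..n}" for i
      using \<sigma> that by fastforce
    moreover have "k + 1 - (k + 1 - \<pi> a) = \<pi> a" if "a \<in> {1..k}" for a
      using \<pi> that by fastforce
    ultimately show "contains_pattern n \<sigma> k \<pi>"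
      using contains_pattern_cong[of n "\<lambda>i. n + 1 - (n + 1 - \<sigma> i)" \<sigma>
          k "\<lambda>a. k + 1 - (k + 1 - \<pi> a)" \<pi>] by blast
  qed (rule contains_pattern_compl[OF \<sigma> \<pi>])
  have "contains_pattern n (\<lambda>j. n + 1 - L i j) k (\<lambda>a. k + 1 - \<pi> a) \<longleftrightarrow>
      contains_pattern n (L i) k \<pi>" if "i \<in> {1..n}" for i
    using latin_gridD(1)[OF L that] by (intro compl) blast
  moreover have "contains_pattern n (\<lambda>i. n + 1 - L i j) k (\<lambda>a. k + 1 - \<pi> a) \<longleftrightarrow>
      contains_pattern n (\<lambda>i. L i j) k \<pi>" if "j \<in> {1..n}" for j
    using latin_gridD(1)[OF L _ that] by (intro compl) blast
  ultimately show "latin_square_avoids n (\<lambda>i j. n + 1 - L i j) k (\<lambda>a. k + 1 - \<pi> a) \<longleftrightarrow>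
      latin_square_avoids n L k \<pi>"
    unfolding latin_square_avoids_def by simp
next
  fix L M :: "nat \<Rightarrow> nat \<Rightarrow> nat" and i j
  assume L: "latin_grid n L" and ij: "i \<in> {1..n}" "j \<in> {1..n}"
    and M: "\<And>i j. i \<in> {1..n} \<Longrightarrow> j \<in> {1..n} \<Longrightarrow> M i j = n + 1 - L i j"
  show "n + 1 - M i j = L i j"
    unfolding M[OF ij] using latin_gridD(1)[OF L ij] by simp
qed

section \<open>Decreasing cycles\<close>

text \<open>For \<open>k\<close> and \<open>j\<close> in \<open>{1..n}\<close> this is the
  representative in \<open>{1..n}\<close> of \<open>k + 1 - j\<close> modulo
  \<open>n\<close>.\<close>

definition dec_cycle :: "nat \<Rightarrow> nat \<Rightarrow> nat \<Rightarrow> nat" where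
  "dec_cycle n k j = (if j \<le> k then k + 1 - j else n + k + 1 - j)"

lemma dec_cycle_in: "k \<in> {1..n} \<Longrightarrow> j \<in> {1..n} \<Longrightarrow> dec_cycle n k j \<in> {1..n}"
  by (auto simp: dec_cycle_def)

lemma dec_cycle_dec_cycle: "k \<in> {1..n} \<Longrightarrow> j \<in> {1..n} \<Longrightarrow> dec_cycle n k (dec_cycle n k j) = j"
  by (auto simp: dec_cycle_def)

text \<open>Both sides represent \<open>k + 2 - i - j\<close> modulo \<open>n\<close>. The grid
  built from decreasing cycles is therefore symmetric, and facts about its rows pass to its
  columns.\<close>

lemma dec_cycle_commute:
  "k \<in> {1..n} \<Longrightarrow> i \<in> {1..n} \<Longrightarrow> j \<in> {1..n} \<Longrightarrow>
    dec_cycle n (dec_cycle n k i) j = dec_cycle n (dec_cycle n k j) i"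
  by (auto simp: dec_cycle_def)

text \<open>The word consists of two decreasing runs, the first with the smaller values. If the
  values at \<open>b < c\<close> ascend, then \<open>b\<close> lies in the first run and
  \<open>c\<close> in the second, so any \<open>a < b\<close> has a value strictly between them.
  This excludes both 123 and 312.\<close>

lemma dec_cycle_avoids:
  assumes "k \<in> {1..n}" "\<pi> 1 < \<pi> 2 \<and> \<pi> 2 < \<pi> 3 \<or> \<pi> 2 < \<pi> 3 \<and> \<pi> 3 < \<pi> 1"
  shows "avoids_pattern n (dec_cycle n k) 3 \<pi>"
proof
  assume "contains_pattern n (dec_cycle n k) 3 \<pi>"
  then obtain a b c where "1 \<le> a" "a < b" "b < c" "c \<le> n"
    "dec_cycle n k a < dec_cycle n k b \<longleftrightarrow> \<pi> 1 < \<pi> 2"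
    "dec_cycle n k c < dec_cycle n k a \<longleftrightarrow> \<pi> 3 < \<pi> 1"
    "dec_cycle n k b < dec_cycle n k c \<longleftrightarrow> \<pi> 2 < \<pi> 3"
    unfolding contains_pattern_3_iff by blast
  then show False using assms by (auto simp: dec_cycle_def split: if_splits)
qed

lemma latin_grid_dec_cycle:
  assumes "c \<in> {1..n}"
  shows "latin_grid n (\<lambda>i j. dec_cycle n (dec_cycle n c i) j)"
proof -
  have bij: "bij_betw (dec_cycle n k) {1..n} {1..n}" if "k \<in> {1..n}" for k
    using that dec_cycle_in dec_cycle_dec_cycle
    by (intro bij_betw_byWitness[where f' = "dec_cycle n k"]) auto
  have "bij_betw (\<lambda>i. dec_cycle n (dec_cycle n c i) j) {1..n} {1..n}" if "j \<in> {1..n}" for j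
    using bij[OF dec_cycle_in[OF assms that]] dec_cycle_commute[OF assms _ that]
    by (subst bij_betw_cong[where g = "dec_cycle n (dec_cycle n c j)"]) auto
  then show ?thesis
    unfolding latin_grid_def using bij dec_cycle_in[OF assms] by blast
qed

lemma latin_square_avoids_dec_cycle:
  assumes "c \<in> {1..n}" "\<pi> 1 < \<pi> 2 \<and> \<pi> 2 < \<pi> 3 \<or> \<pi> 2 < \<pi> 3 \<and> \<pi> 3 < \<pi> 1"
  shows "latin_square_avoids n (\<lambda>i j. dec_cycle n (dec_cycle n c i) j) 3 \<pi>"
proof -
  have "avoids_pattern n (\<lambda>i. dec_cycle n (dec_cycle n c i) j) 3 \<pi>" if "j \<in> {1..n}" for j
    using dec_cycle_avoids[OF dec_cycle_in[OF assms(1) that] assms(2)]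
      contains_pattern_cong[of n "\<lambda>i. dec_cycle n (dec_cycle n c i) j"
        "dec_cycle n (dec_cycle n c j)" 3 \<pi> \<pi>] dec_cycle_commute[OF assms(1) _ that] by simp
  then show ?thesis
    unfolding latin_square_avoids_def using dec_cycle_avoids dec_cycle_in assms by blast
qed

section \<open>Rows of avoiding grids are decreasing cycles\<close>

text \<open>The outer induction is on the first entry \<open>k\<close>, the inner one on the column
  \<open>j\<close>. A wrong entry in column \<open>j\<close> either stands earlier in the row, or
  stands in the same column of a row with smaller first entry, or yields a 123 starting with
  \<open>k\<close>.\<close>

lemma rows_dec_cycle_123:
  assumes L: "latin_grid n L"
    and avoids: "\<And>i a b c. i \<in> {1..n} \<Longrightarrow> 1 \<le> a \<Longrightarrow> a < b \<Longrightarrow> b < c \<Longrightarrow> c \<le> n \<Longrightarrow>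
      L i a < L i b \<Longrightarrow> L i b < L i c \<Longrightarrow> False"
    and "i \<in> {1..n}" "j \<in> {1..n}"
  shows "L i j = dec_cycle n (L i 1) j"
proof -
  note row = latin_gridD[OF L]
  note col = latin_gridD[OF latin_grid_transpose[OF L]]
  have "\<forall>i\<in>{1..n}. L i 1 = k \<longrightarrow> (\<forall>j\<in>{1..n}. L i j = dec_cycle n k j)" for k
  proof (induction k rule: less_induct)
    case (less k)
    show ?case
    proof (intro ballI impI)
      fix i j assume i: "i \<in> {1..n}" and k: "L i 1 = k" and "j \<in> {1..n}"
      then have k1: "k \<in> {1..n}" using row(1)[OF i, of 1] by auto
      \<comment> \<open>Each \<open>m < k\<close> heads some row, because the first column is onto;
        by the outer induction that row is known and occupies its entry in column
        \<open>j\<close>.\<close>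
      have used: False if j: "j \<in> {1..n}" and m: "1 \<le> m" "m < k" and eq: "L i j = dec_cycle n m j"
        for m j
      proof -
        have "m \<in> {1..n}" "1 \<in> {1..n}" using m k1 by auto
        then obtain i' where i': "i' \<in> {1..n}" "L i' 1 = m" using col(3) by blast
        then have "L i' j = L i j" using less m(2) j eq by simp
        then have "i' = i" using col(2) i i' j by blast
        then show False using i' k m by simp
      qed
      show "L i j = dec_cycle n k j" using \<open>j \<in> {1..n}\<close>
      proof (induction j rule: less_induct)
        case (less j)
        define v where "v = L i j"
        define w where "w = dec_cycle n k j"
        note j = less.prems
        have v: "v \<in> {1..n}" using row(1)[OF i j] by (simp add: v_def)
        \<comment> \<open>By the inner induction the earlier columns hold their predicted values, so
          any other value except \<open>v\<close> is still to come.\<close>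
        have later: "\<exists>p. j < p \<and> p \<le> n \<and> L i p = s"
          if s: "s \<in> {1..n}" "s \<noteq> v" "\<And>p. p < j \<Longrightarrow> 1 \<le> p \<Longrightarrow> dec_cycle n k p \<noteq> s" for s
        proof -
          obtain p where p: "p \<in> {1..n}" "L i p = s" using row(3) i s(1) by blast
          moreover have "\<not> p < j" using less.IH[of p] s(3)[of p] p by auto
          moreover have "p \<noteq> j" using p s(2) v_def by blast
          ultimately show ?thesis by (intro exI[of _ p]) auto
        qed
        have new: "v \<noteq> dec_cycle n k p" if "p < j" "1 \<le> p" for p
          using less.IH[of p] row(2)[OF i, of p j] that j unfolding v_def by auto
        show ?case
        proof (cases "j = 1")
          case True
          then show ?thesis using k k1 by (simp add: dec_cycle_def)
        next
          case False
          then have j1: "1 < j" using j by auto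
          \<comment> \<open>The values \<open>k\<close>, \<open>v\<close>, \<open>s\<close> in
            columns \<open>1\<close>, \<open>j\<close> and a later one would form a 123.\<close>
          have peak: False if "k < v" "v < s" "s \<in> {1..n}"
            "\<And>p. p < j \<Longrightarrow> 1 \<le> p \<Longrightarrow> dec_cycle n k p \<noteq> s" for s
            using later[of s] that avoids[OF i, of 1 j] j1 k v_def by auto
          show ?thesis
          proof (cases "j \<le> k")
            case True
            consider "v < k + 1 - j" | "v = k + 1 - j" | "k + 1 - j < v" "v \<le> k" | "k < v" by linarith
            then show ?thesis
            proof cases
              case 1
              \<comment> \<open>The index solves \<open>m + 1 - j = v\<close>: the first run of that
                row has \<open>v\<close> in column \<open>j\<close>.\<close>
              then have "L i j = dec_cycle n (v + j - 1) j" "1 \<le> v + j - 1" "v + j - 1 < k"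
                using v j1 True by (auto simp: dec_cycle_def simp flip: v_def)
              then show ?thesis using used[OF j] by blast
            next
              case 2
              then show ?thesis using True v_def by (simp add: dec_cycle_def)
            next
              case 3
              then have "v = dec_cycle n k (k + 1 - v)" "k + 1 - v < j" "1 \<le> k + 1 - v"
                using v True by (auto simp: dec_cycle_def)
              then show ?thesis using new by blast
            next
              case 4
              \<comment> \<open>The first \<open>j - 1\<close> columns hold values at most
                \<open>k\<close>, so \<open>n\<close> is still to come and \<open>v < n\<close>
                would give a 123.\<close>
              have "v = n"
              proof (rule ccontr)
                assume "v \<noteq> n"
                then have "v < n" "n \<in> {1..n}" using v by auto
                moreover have "dec_cycle n k p \<noteq> n" if "p < j" "1 \<le> p" for p
                  using that 4 \<open>v < n\<close> True by (simp add: dec_cycle_def)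
                ultimately show False using peak[OF 4] by blast
              qed
              \<comment> \<open>The row headed by \<open>j - 1\<close> starts its second run, with
                \<open>n\<close>, in column \<open>j\<close>.\<close>
              then have "L i j = dec_cycle n (j - 1) j" "1 \<le> j - 1" "j - 1 < k"
                using True j1 by (auto simp: dec_cycle_def simp flip: v_def)
              then show ?thesis using used[OF j] by blast
            qed
          next
            case False
            \<comment> \<open>Beyond column \<open>k\<close>, the values up to \<open>k\<close> and
              those above \<open>w\<close> are used up in this row. A value strictly between
              \<open>k\<close> and \<open>w\<close> would leave \<open>w\<close> for later, which
              gives a 123.\<close>
            have "k < v"
            proof (rule ccontr)
              assume "\<not> k < v"
              then have "v = dec_cycle n k (k + 1 - v)" "k + 1 - v < j" "1 \<le> k + 1 - v"
                using v False by (auto simp: dec_cycle_def)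
              then show False using new by blast
            qed
            moreover have "v \<le> w"
            proof (rule ccontr)
              assume "\<not> v \<le> w"
              then have "v = dec_cycle n k (n + k + 1 - v)" "n + k + 1 - v < j" "1 \<le> n + k + 1 - v"
                using v False j k1 by (auto simp: w_def dec_cycle_def)
              then show False using new by blast
            qed
            moreover have "\<not> v < w"
            proof
              assume "v < w"
              moreover have "dec_cycle n k p \<noteq> w" if "p < j" "1 \<le> p" for p
                using that False j k1 by (auto simp: w_def dec_cycle_def)
              ultimately show False using peak[of w] \<open>k < v\<close> dec_cycle_in[OF k1 j] w_def by blast
            qed
            ultimately show ?thesis by (simp add: v_def w_def)
          qed
        qed
      qed
    qed
  qed
  then show ?thesis using assms(3,4) by blast
qed

text \<open>Rows are settled by decreasing first entry, so the column argument now excludes entries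
  of rows with larger first entries. Within a row, the values up to \<open>k\<close> are located
  first, and the other columns are then filled from the right end.\<close>

lemma rows_dec_cycle_312:
  assumes L: "latin_grid n L"
    and avoids: "\<And>i a b c. i \<in> {1..n} \<Longrightarrow> 1 \<le> a \<Longrightarrow> a < b \<Longrightarrow> b < c \<Longrightarrow> c \<le> n \<Longrightarrow>
      L i b < L i c \<Longrightarrow> L i c < L i a \<Longrightarrow> False"
    and "i \<in> {1..n}" "j \<in> {1..n}"
  shows "L i j = dec_cycle n (L i 1) j"
proof -
  note row = latin_gridD[OF L]
  note col = latin_gridD[OF latin_grid_transpose[OF L]]
  have "\<forall>i\<in>{1..n}. L i 1 = k \<longrightarrow> (\<forall>j\<in>{1..n}. L i j = dec_cycle n k j)" for k
  proof (induction "n - k" arbitrary: k rule: less_induct)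
    case less
    show ?case
    proof (intro ballI impI)
      fix i j assume i: "i \<in> {1..n}" and k: "L i 1 = k" and j: "j \<in> {1..n}"
      then have k1: "k \<in> {1..n}" using row(1)[OF i, of 1] by auto
      have used: False if j: "j \<in> {1..n}" and m: "k < m" "m \<le> n" and eq: "L i j = dec_cycle n m j"
        for m j
      proof -
        have "m \<in> {1..n}" "1 \<in> {1..n}" using m k1 by auto
        then obtain i' where i': "i' \<in> {1..n}" "L i' 1 = m" using col(3) by blast
        have "n - m < n - k" using m by linarith
        then have "L i' j = L i j" using less i' j eq by metis
        then have "i' = i" using col(2) i i' j by blast
        then show False using i' k m by simp
      qed
      \<comment> \<open>Going up from \<open>s = 1\<close>, each value \<open>Suc s\<close> must
        stand left of \<open>s\<close>, since otherwise \<open>k\<close>, \<open>s\<close>,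
        \<open>Suc s\<close> would form a 312; so the bound drops by one each time.\<close>
      have pos_le: "p \<le> k + 1 - s" if "1 \<le> s" "s \<le> k" "p \<in> {1..n}" "L i p = s" for s p
        using that
      proof (induction s arbitrary: p rule: nat_induct_at_least)
        case base
        show ?case
        proof (rule ccontr)
          assume "\<not> p \<le> k + 1 - 1"
          \<comment> \<open>The row headed by \<open>p\<close> has its \<open>1\<close> in column
            \<open>p\<close>.\<close>
          then have "L i p = dec_cycle n p p" "k < p" "p \<le> n"
            using base by (auto simp: dec_cycle_def)
          then show False using used base(2) by blast
        qed
      next
        case (Suc s)
        then obtain q where q: "q \<in> {1..n}" "L i q = s" using row(3)[OF i, of s] k1 by auto
        then have "q \<le> k + 1 - s" using Suc by simp
        moreover have "p < q"
        proof (rule ccontr)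
          assume "\<not> p < q"
          then have "q < p" using q Suc.prems by (cases "p = q") auto
          moreover have "1 < q" using q k Suc.prems by (cases "q = 1") auto
          \<comment> \<open>If \<open>Suc s\<close> were \<open>k\<close>, it would stand in column
            \<open>1\<close>, leaving no room for \<open>q\<close> before it.\<close>
          moreover have "Suc s < k"
          proof (rule ccontr)
            assume "\<not> Suc s < k"
            then have "p = 1" using row(2)[OF i, of p 1] Suc.prems k k1 by auto
            then show False using \<open>q < p\<close> q by auto
          qed
          ultimately show False using avoids[OF i, of 1 q p] q Suc.prems k by auto
        qed
        ultimately show ?case by linarith
      qed
      \<comment> \<open>By \<open>pos_le\<close> the value \<open>k + 1 - j\<close> lies in the
        first \<open>j\<close> columns, and by induction all of these before the last hold other
        values.\<close>
      have small: "L i j = k + 1 - j" if "1 \<le> j" "j \<le> k" for j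
        using that
      proof (induction j rule: less_induct)
        case (less j)
        have "k + 1 - j \<in> {1..n}" using k1 less.prems by auto
        then obtain p where p: "p \<in> {1..n}" "L i p = k + 1 - j" using row(3)[OF i] by blast
        have "p \<le> j" using pos_le[of "k + 1 - j" p] p less.prems by auto
        moreover have "\<not> p < j" using less.IH[of p] p less.prems by auto
        ultimately show ?case using p by auto
      qed
      \<comment> \<open>The values up to \<open>k\<close> fill the first \<open>k\<close> columns,
        and those strictly between \<open>k\<close> and the target already stand to the right of
        \<open>j\<close>.\<close>
      have large: "L i j = n + k + 1 - j" if "k < j" "j \<le> n" for j
        using that
      proof (induction "n - j" arbitrary: j rule: less_induct)
        case less
        have j: "j \<in> {1..n}" using less.prems by auto
        define v where "v = L i j"
        have v: "v \<in> {1..n}" using row(1)[OF i j] by (simp add: v_def)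
        have "k < v"
        proof (rule ccontr)
          assume "\<not> k < v"
          then have "L i (k + 1 - v) = v" using small[of "k + 1 - v"] v by auto
          moreover have "k + 1 - v \<in> {1..n}" using \<open>\<not> k < v\<close> v k1 by auto
          ultimately have "k + 1 - v = j" using row(2)[OF i _ j] v_def by simp
          then show False using v less.prems by auto
        qed
        moreover have "\<not> v < n + k + 1 - j"
        proof
          assume "v < n + k + 1 - j"
          then have "L i (n + k + 1 - v) = v"
            using less.hyps[of "n + k + 1 - v"] v \<open>k < v\<close> less.prems by auto
          moreover have "n + k + 1 - v \<in> {1..n}" using \<open>k < v\<close> v by auto
          ultimately have "n + k + 1 - v = j" using row(2)[OF i _ j] v_def by simp
          then show False using \<open>v < n + k + 1 - j\<close> v by auto
        qed
        moreover have "\<not> n + k + 1 - j < v"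
        proof
          assume "n + k + 1 - j < v"
          \<comment> \<open>The index solves \<open>n + m + 1 - j = v\<close>. It is below
            \<open>j\<close> since \<open>v \<le> n\<close>, so column \<open>j\<close> is in the
            second run of that row, and it exceeds \<open>k\<close> since \<open>v\<close> exceeds
            the target.\<close>
          then have "L i j = dec_cycle n (v + j - n - 1) j" "k < v + j - n - 1" "v + j - n - 1 \<le> n"
            using v less.prems by (auto simp: dec_cycle_def simp flip: v_def)
          then show False using used[OF j] by blast
        qed
        ultimately show ?case by (simp add: v_def)
      qed
      show "L i j = dec_cycle n k j" using small large j by (auto simp: dec_cycle_def)
    qed
  qed
  then show ?thesis using assms(3,4) by blast
qed

text \<open>Avoidance is assumed for rows only, so that the lemma also applies to the transpose and
  describes the columns.\<close>

lemma rows_dec_cycle: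
  assumes \<pi>: "\<pi> 1 < \<pi> 2 \<and> \<pi> 2 < \<pi> 3 \<or> \<pi> 2 < \<pi> 3 \<and> \<pi> 3 < \<pi> 1"
    and L: "latin_grid n L" "\<forall>i\<in>{1..n}. avoids_pattern n (L i) 3 \<pi>"
    and ij: "i \<in> {1..n}" "j \<in> {1..n}"
  shows "L i j = dec_cycle n (L i 1) j"
  using \<pi>
proof
  assume "\<pi> 1 < \<pi> 2 \<and> \<pi> 2 < \<pi> 3"
  with L(2) show ?thesis
    unfolding contains_pattern_3_iff
    by (intro rows_dec_cycle_123[OF L(1) _ ij]) (smt (verit) less_trans less_asym)
next
  assume "\<pi> 2 < \<pi> 3 \<and> \<pi> 3 < \<pi> 1"
  with L(2) show ?thesis
    unfolding contains_pattern_3_iff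
    by (intro rows_dec_cycle_312[OF L(1) _ ij]) (smt (verit) less_trans less_asym)
qed

section \<open>Counting the avoiding squares\<close>

lemma num_avoiding_latin_squares_123_312:
  assumes "n \<ge> 1" and \<pi>: "\<pi> 1 < \<pi> 2 \<and> \<pi> 2 < \<pi> 3 \<or> \<pi> 2 < \<pi> 3 \<and> \<pi> 3 < \<pi> 1"
  shows "num_avoiding_latin_squares n 3 \<pi> = n"
proof -
  define G where "G c = restrict_grid n (\<lambda>i j. dec_cycle n (dec_cycle n c i) j)" for c
  have "{L \<in> latin_squares n. latin_square_avoids n L 3 \<pi>} = G ` {1..n}"
  proof (intro equalityI subsetI)
    fix L assume "L \<in> {L \<in> latin_squares n. latin_square_avoids n L 3 \<pi>}"
    then have sq: "L \<in> latin_squares n" and L: "latin_grid n L" and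
      rows: "\<forall>i\<in>{1..n}. avoids_pattern n (L i) 3 \<pi>" and
      cols: "\<forall>j\<in>{1..n}. avoids_pattern n (\<lambda>i. L i j) 3 \<pi>"
      by (simp_all add: latin_squares_iff latin_square_avoids_def)
    have "G (L 1 1) = L"
      unfolding G_def
    proof (rule restrict_grid_eqI[OF sq])
      fix i j assume ij: "i \<in> {1..n}" "j \<in> {1..n}"
      then have "1 \<in> {1..n}" by auto
      \<comment> \<open>Avoidance in the columns expresses \<open>L i 1\<close> through
        \<open>L 1 1\<close>; avoidance in the rows expresses \<open>L i j\<close> through
        \<open>L i 1\<close>.\<close>
      then show "dec_cycle n (dec_cycle n (L 1 1) i) j = L i j"
        using rows_dec_cycle[OF \<pi> L rows ij]
          rows_dec_cycle[OF \<pi> latin_grid_transpose[OF L] cols _ ij(1), of 1] by simp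
    qed
    moreover have "L 1 1 \<in> {1..n}" using latin_gridD(1)[OF L, of 1 1] assms(1) by auto
    ultimately show "L \<in> G ` {1..n}" by (metis image_eqI)
  next
    fix L assume "L \<in> G ` {1..n}"
    then obtain c where c: "c \<in> {1..n}" "L = G c" by blast
    then have "latin_square_avoids n L 3 \<pi>"
      using latin_square_avoids_dec_cycle[OF c(1) \<pi>]
        latin_square_avoids_cong[of n "G c" "\<lambda>i j. dec_cycle n (dec_cycle n c i) j"]
      by (simp add: G_def)
    then show "L \<in> {L \<in> latin_squares n. latin_square_avoids n L 3 \<pi>}"
      using c restrict_grid_latin_square[OF latin_grid_dec_cycle[OF c(1)]] by (simp add: G_def)
  qed
  moreover have "inj_on G {1..n}"
  proof (rule inj_onI)
    fix c d assume cd: "c \<in> {1..n}" "d \<in> {1..n}" "G c = G d"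
    then have "G c 1 1 = G d 1 1" "1 \<in> {1..n}" by auto
    \<comment> \<open>The top left entry of \<open>G c\<close> is \<open>c\<close>.\<close>
    then show "c = d" using cd(1,2) by (simp add: G_def dec_cycle_def)
  qed
  ultimately show ?thesis
    by (simp add: num_avoiding_latin_squares_def card_image)
qed

theorem theorem2:
  fixes n :: nat and \<pi> :: "nat \<Rightarrow> nat"
  assumes "n \<ge> 1" and "\<pi> permutes {1..3}"
  shows "num_avoiding_latin_squares n 3 \<pi> = n"
proof -
  have \<pi>: "\<pi> ` {1..3} = {1..3}" using assms(2) by (rule permutes_image)
  then have range: "\<pi> ` {1..3} \<subseteq> {1..3}" by simp
  have le: "\<pi> 1 \<le> 3" "\<pi> 2 \<le> 3" "\<pi> 3 \<le> 3" using range by (auto simp: image_subset_iff)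
  have "\<pi> 1 \<noteq> \<pi> 2" "\<pi> 1 \<noteq> \<pi> 3" "\<pi> 2 \<noteq> \<pi> 3"
    using permutes_inj[OF assms(2)] by (simp_all add: inj_eq)
  \<comment> \<open>The cases are grouped by the symmetry that leads to 123 or 312: none for these
    two, reversal for 321 and 213, complementation for 132, and both for 231.\<close>
  then consider "\<pi> 1 < \<pi> 2 \<and> \<pi> 2 < \<pi> 3 \<or> \<pi> 2 < \<pi> 3 \<and> \<pi> 3 < \<pi> 1"
    | "\<pi> 3 < \<pi> 2 \<and> \<pi> 2 < \<pi> 1 \<or> \<pi> 2 < \<pi> 1 \<and> \<pi> 1 < \<pi> 3"
    | "\<pi> 1 < \<pi> 3 \<and> \<pi> 3 < \<pi> 2" | "\<pi> 3 < \<pi> 1 \<and> \<pi> 1 < \<pi> 2"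
    by linarith
  then show ?thesis
  proof cases
    case 1
    then show ?thesis by (rule num_avoiding_latin_squares_123_312[OF assms(1)])
  next
    case 2
    then have "num_avoiding_latin_squares n 3 (\<lambda>a. \<pi> (3 + 1 - a)) = n"
      by (intro num_avoiding_latin_squares_123_312[OF assms(1)]) auto
    then show ?thesis by (simp only: num_avoiding_latin_squares_rev)
  next
    case 3
    then have "num_avoiding_latin_squares n 3 (\<lambda>a. 3 + 1 - \<pi> a) = n"
      using le by (intro num_avoiding_latin_squares_123_312[OF assms(1)]) auto
    then show ?thesis by (simp only: num_avoiding_latin_squares_compl[OF range])
  next
    case 4
    then have "num_avoiding_latin_squares n 3 (\<lambda>a. 3 + 1 - \<pi> (3 + 1 - a)) = n"
      using le by (intro num_avoiding_latin_squares_123_312[OF assms(1)]) auto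
    then show ?thesis
      by (simp only: num_avoiding_latin_squares_rev[of n 3 "\<lambda>a. 3 + 1 - \<pi> a"]
          num_avoiding_latin_squares_compl[OF range])
  qed
qed

end
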